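(* The category $\mathbf{Cat_{pmv}}$ of small categories and partial multivalued functors is isomorphic to the full subcategory of $\mathbf{Rel_1}$ (the Kleisli category of the power categorder monad $\mathcal{P}_1$ on $\mathbf{Cat_1}$) spanned by the categories, i.e. by those small categorders in which every hom set carries the discrete (equality) ordering.
   Context: **Partial multivalued functors.** A partial multivalued function $S\nrightarrow T$ between sets is a function $S\to\mathcal{P}(T)$ to the power set of $T$. A partial multivalued functor $F\colon\mathscr{C}\nrightarrow\mathscr{D}$ between small categories consists of a partial multivalued function $F\colon\mathrm{ob}\,\mathscr{C}\nrightarrow\mathrm{ob}\,\mathscr{D}$ and, for all $C,C'\in\mathrm{ob}\,\mathscr{C}$, a partial multivalued function $F\colon\mathscr{C}(C,C')\nrightarrow\bigcup_{D\in FC,\,D'\in FC'}\mathscr{D}(D,D')$ such that: (i) for all objects $C$ of $\mathscr C$, if $d\in F(\mathrm{id}_C)$ then $d=\mathrm{id}_D$ for some $D\in FC$; (ii) for all morphisms $c''$ of $\mathscr{C}$ and $d''$ of $\mathscr{D}$ with $d''\in F(c'')$, if $c''=c'\circ c$ for morphisms $c,c'$ of $\mathscr C$, then there exist $d\in F(c)$ and $d'\in F(c')$ with $d''=d'\circ d$. The category $\mathbf{Cat_{pmv}}$ has small categories as objects and partial multivalued functors as morphisms; the identities are $C\mapsto\{C\}$, $c\mapsto\{c\}$, and the composite of $F\colon\mathscr{C}\nrightarrow\mathscr{D}$ and $G\colon\mathscr{D}\nrightarrow\mathscr{E}$ is $C\mapsto\bigcup_{D\in FC}GD$, $c\mapsto\bigcup_{d\in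 Fc}Gd$. **Categorders and functorders.** An ordering is a partial order. A categorder is a category $\mathscr{C}$ with an ordering on each hom set such that for $c_1,c_2\colon C\to C'$ and $c_1',c_2'\colon C'\to C''$, $c_1\le c_2$ and $c_1'\le c_2'$ imply $c_1'\circ c_1\le c_2'\circ c_2$. A functorder $F\colon\mathscr{C}\to\mathscr{D}$ between categorders consists of a function $F\colon\mathrm{ob}\,\mathscr{C}\to\mathrm{ob}\,\mathscr{D}$ and functions $F\colon\mathscr{C}(C,C')\to\mathscr{D}(FC,FC')$ that are monotone ($c\le c'$ implies $Fc\le Fc'$) and satisfy $F(\mathrm{id}_C)\le\mathrm{id}_{FC}$ and $F(c'\circ c)\le Fc'\circ Fc$. $\mathbf{Cat_1}$ is the category of small categorders and functorders, with the evident identities and composition. A category is regarded as a categorder with the discrete ordering ($c\le c'$ iff $c=c'$) on each hom set. **Power categorder.** For a small categorder $\mathscr{C}$, order $\mathrm{mor}\,\mathscr{C}$ by the orderings of the hom sets (morphisms in different hom sets are incomparable), and write ${\downarrow}A$ for the down closure of $A\subseteq\mathrm{mor}\,\mathscr{C}$. The categorder $\mathcal{P}_1\mathscr{C}$ has as objects all subsets $\mathcal{C}\subseteq\mathrm{ob}\,\mathscr{C}$; its morphisms $\mathcal{C}\to\mathcal{C}'$ are the down closed subsets of $\mathscr{C}(\mathcal{C},\mathcal{C}')=\bigcup_{C\in\mathcal{C},C'\in\mathcal{C}'}\mathscr{C}(C,C')$, ordered by inclusion (the same set of morphisms occurring in different hom sets is regarded as giving different morphisms); $\mathrm{id}_{\mathcal{C}}={\downarrow}\{\mathrm{id}_C\mid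 C\in\mathcal{C}\}$; and $\mathbf{c}'\circ\mathbf{c}={\downarrow}\{c'\circ c\mid c\in\mathbf{c},\,c'\in\mathbf{c}',\ c'\circ c\text{ defined}\}$. For a functorder $F\colon\mathscr{C}\to\mathscr{D}$, $\mathcal{P}_1F=F_{\to}\colon\mathcal{P}_1\mathscr{C}\to\mathcal{P}_1\mathscr{D}$ is given by $F_{\to}(\mathcal{C})=\{FC\mid C\in\mathcal{C}\}$ and $F_{\to}(\mathbf{c})={\downarrow}\{Fc\mid c\in\mathbf{c}\}$. **Monad structure.** The unit $\eta_{\mathscr{C}}\colon\mathscr{C}\to\mathcal{P}_1\mathscr{C}$ is $C\mapsto\{C\}$, $c\mapsto{\downarrow}\{c\}$. The multiplication $\mu_{\mathscr{C}}\colon\mathcal{P}_1\mathcal{P}_1\mathscr{C}\to\mathcal{P}_1\mathscr{C}$ is given by unions, both on objects ($\mathbb{C}\mapsto\bigcup\mathbb{C}$) and on morphisms (a down closed collection of morphisms $\mathbf{c}$ of $\mathcal{P}_1\mathscr{C}$ is sent to the union of the sets $\mathbf{c}$). These make $\mathcal{P}_1$ a monad on $\mathbf{Cat_1}$. **$\mathbf{Rel_1}$.** This is the Kleisli category of this monad: objects are small categorders, morphisms $F\colon\mathscr{C}\nrightarrow\mathscr{D}$ are functorders $\hat F\colon\mathscr{C}\to\mathcal{P}_1\mathscr{D}$, the identity at $\mathscr{C}$ is $\eta_{\mathscr{C}}$, and the composite of $F\colon\mathscr{C}\nrightarrow\mathscr{D}$ with $G\colon\mathscr{D}\nrightarrow\mathscr{E}$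 is $\mu_{\mathscr{E}}\circ\mathcal{P}_1(\hat G)\circ\hat F$. *)

theory Defs
  imports Main "HOL-Library.FuncSet"
begin

text \<open>
  A small category has its objects in a type \<open>'o\<close> and its morphisms in a type \<open>'m\<close>. All structure
  maps are required to be \<open>undefined\<close> off their domain, so that two records are equal iff they are
  the same category, and likewise for functor-like maps.
\<close>

record ('o, 'm) cat =
  Ob :: "'o set"
  Mor :: "'m set"
  Dom :: "'m \<Rightarrow> 'o"
  Cod :: "'m \<Rightarrow> 'o"
  Idn :: "'o \<Rightarrow> 'm"
  Cmp :: "'m \<Rightarrow> 'm \<Rightarrow> 'm"  \<comment> \<open>\<open>Cmp C g f\<close> is \<open>g\<close> after \<open>f\<close>\<close>

definition Hom :: "('o, 'm, 'z) cat_scheme \<Rightarrow> 'o \<Rightarrow> 'o \<Rightarrow> 'm set" where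
  "Hom C X Y = {f \<in> Mor C. Dom C f = X \<and> Cod C f = Y}"

definition composable :: "('o, 'm, 'z) cat_scheme \<Rightarrow> 'm \<Rightarrow> 'm \<Rightarrow> bool" where
  "composable C g f \<longleftrightarrow> f \<in> Mor C \<and> g \<in> Mor C \<and> Dom C g = Cod C f"

locale category =
  fixes C :: "('o, 'm, 'z) cat_scheme"
  assumes Dom: "Dom C \<in> Mor C \<rightarrow>\<^sub>E Ob C"
    and Cod: "Cod C \<in> Mor C \<rightarrow>\<^sub>E Ob C"
    and Idn: "Idn C \<in> (\<Pi>\<^sub>E X\<in>Ob C. Hom C X X)"
    and Cmp: "composable C g f \<Longrightarrow> Cmp C g f \<in> Hom C (Dom C f) (Cod C g)"
    and Cmp_undefined: "\<not> composable C g f \<Longrightarrow> Cmp C g f = undefined"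
    and Cmp_Idn: "f \<in> Mor C \<Longrightarrow> Cmp C f (Idn C (Dom C f)) = f"
    and Idn_Cmp: "f \<in> Mor C \<Longrightarrow> Cmp C (Idn C (Cod C f)) f = f"
    and assoc: "composable C g f \<Longrightarrow> composable C h g \<Longrightarrow>
      Cmp C h (Cmp C g f) = Cmp C (Cmp C h g) f"

text \<open>The ordering is a relation on the set of all morphisms that relates only parallel ones.\<close>

record ('o, 'm) cato = "('o, 'm) cat" +
  Le :: "('m \<times> 'm) set"

locale categorder = category C for C :: "('o, 'm, 'z) cato_scheme" +
  assumes order: "partial_order_on (Mor C) (Le C)"
    and parallel: "(f, g) \<in> Le C \<Longrightarrow> Dom C f = Dom C g \<and> Cod C f = Cod C g"
    and Cmp_mono: "composable C g f \<Longrightarrow> composable C g' f' \<Longrightarrow>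
      (f, f') \<in> Le C \<Longrightarrow> (g, g') \<in> Le C \<Longrightarrow> (Cmp C g f, Cmp C g' f') \<in> Le C"

definition discrete :: "('o, 'm, 'z) cato_scheme \<Rightarrow> bool" where
  "discrete C \<longleftrightarrow> (\<forall>f\<in>Mor C. \<forall>g\<in>Mor C. (f, g) \<in> Le C \<longleftrightarrow> f = g)"

record ('o, 'm, 'p, 'n) fmap =
  ObF :: "'o \<Rightarrow> 'p"
  MorF :: "'m \<Rightarrow> 'n"

definition fmap_id :: "('o, 'm, 'z) cat_scheme \<Rightarrow> ('o, 'm, 'o, 'm) fmap" where
  "fmap_id C = \<lparr> ObF = (\<lambda>X\<in>Ob C. X), MorF = (\<lambda>f\<in>Mor C. f) \<rparr>"

definition fmap_comp :: "('o, 'm, 'z) cat_scheme \<Rightarrow> ('p, 'n, 'q, 'k) fmap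
    \<Rightarrow> ('o, 'm, 'p, 'n) fmap \<Rightarrow> ('o, 'm, 'q, 'k) fmap" where
  "fmap_comp C G F =
     \<lparr> ObF = (\<lambda>X\<in>Ob C. ObF G (ObF F X)), MorF = (\<lambda>f\<in>Mor C. MorF G (MorF F f)) \<rparr>"

definition fmap_between :: "('o, 'm, 'z) cat_scheme \<Rightarrow> ('p, 'n, 'y) cat_scheme
    \<Rightarrow> ('o, 'm, 'p, 'n) fmap \<Rightarrow> bool" where
  "fmap_between C D F \<longleftrightarrow>
     ObF F \<in> Ob C \<rightarrow>\<^sub>E Ob D \<and>
     MorF F \<in> (\<Pi>\<^sub>E f\<in>Mor C. Hom D (ObF F (Dom C f)) (ObF F (Cod C f)))"

definition is_functor :: "('o, 'm, 'z) cat_scheme \<Rightarrow> ('p, 'n, 'y) cat_scheme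
    \<Rightarrow> ('o, 'm, 'p, 'n) fmap \<Rightarrow> bool" where
  "is_functor C D F \<longleftrightarrow> category C \<and> category D \<and> fmap_between C D F \<and>
     (\<forall>X\<in>Ob C. MorF F (Idn C X) = Idn D (ObF F X)) \<and>
     (\<forall>f g. composable C g f \<longrightarrow> MorF F (Cmp C g f) = Cmp D (MorF F g) (MorF F f))"

definition isomorphic_cats :: "('o, 'm, 'z) cat_scheme \<Rightarrow> ('p, 'n, 'y) cat_scheme \<Rightarrow> bool" where
  "isomorphic_cats C D \<longleftrightarrow> (\<exists>F G. is_functor C D F \<and> is_functor D C G \<and>
     fmap_comp C G F = fmap_id C \<and> fmap_comp D F G = fmap_id D)"

definition full_subcat :: "('o, 'm, 'z) cat_scheme \<Rightarrow> 'o set \<Rightarrow> ('o, 'm) cat" where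
  "full_subcat C S =
     (let M = {f \<in> Mor C. Dom C f \<in> S \<and> Cod C f \<in> S} in
      \<lparr> Ob = Ob C \<inter> S, Mor = M, Dom = restrict (Dom C) M, Cod = restrict (Cod C) M,
        Idn = restrict (Idn C) (Ob C \<inter> S),
        Cmp = (\<lambda>g f. if f \<in> M \<and> g \<in> M \<and> Dom C g = Cod C f then Cmp C g f else undefined) \<rparr>)"

definition functorder :: "('o, 'm, 'z) cato_scheme \<Rightarrow> ('p, 'n, 'y) cato_scheme
    \<Rightarrow> ('o, 'm, 'p, 'n) fmap \<Rightarrow> bool" where
  "functorder C D F \<longleftrightarrow> categorder C \<and> categorder D \<and> fmap_between C D F \<and>
     (\<forall>f g. (f, g) \<in> Le C \<longrightarrow> (MorF F f, MorF F g) \<in> Le D) \<and>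
     (\<forall>X\<in>Ob C. (MorF F (Idn C X), Idn D (ObF F X)) \<in> Le D) \<and>
     (\<forall>f g. composable C g f \<longrightarrow> (MorF F (Cmp C g f), Cmp D (MorF F g) (MorF F f)) \<in> Le D)"

text \<open>
  An arrow \<open>Arr X a Y\<close> is a datum \<open>a\<close> tagged with its source and target, so that the same datum may
  occur in different hom sets. \<open>arr_cat S H i c\<close> has object set \<open>S\<close>, the elements of \<open>H X Y\<close> as
  morphisms from \<open>X\<close> to \<open>Y\<close>, identities \<open>i X\<close>, and \<open>c X Y Z b a\<close> as the composite of \<open>a \<in> H X Y\<close>
  with \<open>b \<in> H Y Z\<close>.
\<close>

datatype ('x, 'a) arr = Arr (Src: 'x) (Via: 'a) (Tgt: 'x)

definition arr_cat :: "'x set \<Rightarrow> ('x \<Rightarrow> 'x \<Rightarrow> 'a set) \<Rightarrow> ('x \<Rightarrow> 'a)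
    \<Rightarrow> ('x \<Rightarrow> 'x \<Rightarrow> 'x \<Rightarrow> 'a \<Rightarrow> 'a \<Rightarrow> 'a) \<Rightarrow> ('x, ('x, 'a) arr) cat" where
  "arr_cat S H i c =
     (let M = {Arr X a Y | X a Y. X \<in> S \<and> Y \<in> S \<and> a \<in> H X Y} in
      \<lparr> Ob = S, Mor = M, Dom = restrict Src M, Cod = restrict Tgt M,
        Idn = (\<lambda>X\<in>S. Arr X (i X) X),
        Cmp = (\<lambda>g f. if f \<in> M \<and> g \<in> M \<and> Src g = Tgt f
          then Arr (Src f) (c (Src f) (Tgt f) (Tgt g) (Via g) (Via f)) (Tgt g)
          else undefined) \<rparr>)"

definition down :: "('o, 'm, 'z) cato_scheme \<Rightarrow> 'm set \<Rightarrow> 'm set" where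
  "down C A = {f. \<exists>g\<in>A. (f, g) \<in> Le C}"

definition Homs :: "('o, 'm, 'z) cat_scheme \<Rightarrow> 'o set \<Rightarrow> 'o set \<Rightarrow> 'm set" where
  "Homs C A B = (\<Union>X\<in>A. \<Union>Y\<in>B. Hom C X Y)"

definition P1 :: "('o, 'm, 'z) cato_scheme \<Rightarrow> ('o set, ('o set, 'm set) arr) cato" where
  "P1 C =
     (let K = arr_cat (Pow (Ob C))
            (\<lambda>A B. {s. s \<subseteq> Homs C A B \<and> down C s \<subseteq> s})
            (\<lambda>A. down C (Idn C ` A))
            (\<lambda>_ _ _ t s. down C {Cmp C g f | g f. f \<in> s \<and> g \<in> t \<and> composable C g f})
      in cat.extend K (cato.fields
           {(s, t). s \<in> Mor K \<and> t \<in> Mor K \<and> Src s = Src t \<and> Tgt s = Tgt t \<and> Via s \<subseteq> Via t}))"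

definition P1_map :: "('o, 'm, 'z) cato_scheme \<Rightarrow> ('p, 'n, 'y) cato_scheme \<Rightarrow> ('o, 'm, 'p, 'n) fmap
    \<Rightarrow> ('o set, ('o set, 'm set) arr, 'p set, ('p set, 'n set) arr) fmap" where
  "P1_map C D F =
     \<lparr> ObF = (\<lambda>A\<in>Ob (P1 C). ObF F ` A),
       MorF = (\<lambda>s\<in>Mor (P1 C).
         Arr (ObF F ` Src s) (down D (MorF F ` Via s)) (ObF F ` Tgt s)) \<rparr>"

definition eta :: "('o, 'm, 'z) cato_scheme \<Rightarrow> ('o, 'm, 'o set, ('o set, 'm set) arr) fmap" where
  "eta C =
     \<lparr> ObF = (\<lambda>X\<in>Ob C. {X}),
       MorF = (\<lambda>f\<in>Mor C. Arr {Dom C f} (down C {f}) {Cod C f}) \<rparr>"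

definition mu :: "('o, 'm, 'z) cato_scheme \<Rightarrow>
    ('o set set, ('o set set, ('o set, 'm set) arr set) arr, 'o set, ('o set, 'm set) arr) fmap" where
  "mu C =
     \<lparr> ObF = (\<lambda>\<A>\<in>Ob (P1 (P1 C)). \<Union>\<A>),
       MorF = (\<lambda>\<s>\<in>Mor (P1 (P1 C)). Arr (\<Union>(Src \<s>)) (\<Union>(Via ` Via \<s>)) (\<Union>(Tgt \<s>))) \<rparr>"

text \<open>
  \<open>P1\<close> raises the types of objects and morphisms, so it is an endofunctor only up to this change of
  types; the Kleisli composite below is nevertheless well typed.
\<close>

type_synonym ('o, 'm) rel1_map = "('o, 'm, 'o set, ('o set, 'm set) arr) fmap"

definition Rel1 :: "(('o, 'm) cato, (('o, 'm) cato, ('o, 'm) rel1_map) arr) cat" where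
  "Rel1 = arr_cat {C. categorder C}
     (\<lambda>C D. {F. functorder C (P1 D) F})
     eta
     (\<lambda>C D E G F. fmap_comp C (mu E) (fmap_comp C (P1_map D (P1 E) G) F))"

type_synonym ('o, 'm) pmv_map = "('o, 'm, 'o set, 'm set) fmap"

definition pmv_functor :: "('o, 'm) cat \<Rightarrow> ('p, 'n) cat \<Rightarrow> ('o, 'm, 'p set, 'n set) fmap \<Rightarrow> bool"
  where
  "pmv_functor C D F \<longleftrightarrow> category C \<and> category D \<and>
     ObF F \<in> Ob C \<rightarrow>\<^sub>E Pow (Ob D) \<and>
     MorF F \<in> (\<Pi>\<^sub>E f\<in>Mor C. Pow (Homs D (ObF F (Dom C f)) (ObF F (Cod C f)))) \<and>
     (\<forall>X\<in>Ob C. \<forall>d\<in>MorF F (Idn C X). \<exists>Y\<in>ObF F X. d = Idn D Y) \<and>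
     (\<forall>f g. composable C g f \<longrightarrow> (\<forall>d''\<in>MorF F (Cmp C g f).
        \<exists>d\<in>MorF F f. \<exists>d'\<in>MorF F g. composable D d' d \<and> d'' = Cmp D d' d))"

definition Cat_pmv :: "(('o, 'm) cat, (('o, 'm) cat, ('o, 'm) pmv_map) arr) cat" where
  "Cat_pmv = arr_cat {C. category C}
     (\<lambda>C D. {F. pmv_functor C D F})
     (\<lambda>C. \<lparr> ObF = (\<lambda>X\<in>Ob C. {X}), MorF = (\<lambda>f\<in>Mor C. {f}) \<rparr>)
     (\<lambda>C D E G F. \<lparr> ObF = (\<lambda>X\<in>Ob C. \<Union>Y\<in>ObF F X. ObF G Y),
                      MorF = (\<lambda>f\<in>Mor C. \<Union>d\<in>MorF F f. MorF G d) \<rparr>)"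

end

theory Submission
  imports Defs
begin

text \<open>
  Over a discretely ordered target every set of morphisms is down closed, so a functorder
  \<open>C \<rightarrow> P1 D\<close> between categories is a multivalued map on objects and morphisms; its two lax conditions
  \<open>F id \<subseteq> id\<close> and \<open>F (g f) \<subseteq> F g F f\<close> are literally conditions (i) and (ii) on a partial multivalued
  functor. For any Kleisli extension the down closure in \<open>P1_map\<close> is absorbed by the union in
  \<open>mu\<close>, because the order of \<open>P1\<close> is inclusion, and what remains is the composition of \<open>Cat_pmv\<close>.
  That the full subcategory of \<open>Rel1\<close> is a category is inherited from \<open>Cat_pmv\<close> along this bijection,
  so the monad laws of \<open>P1\<close> are never needed.
\<close>

section \<open>Categories of tagged arrows\<close>

lemma Ob_arr_cat [simp]: "Ob (arr_cat S H i c) = S"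
  by (simp add: arr_cat_def Let_def)

lemma Mor_arr_cat:
  "Mor (arr_cat S H i c) = {f. Src f \<in> S \<and> Tgt f \<in> S \<and> Via f \<in> H (Src f) (Tgt f)}"
proof -
  have "f \<in> Mor (arr_cat S H i c) \<longleftrightarrow> Src f \<in> S \<and> Tgt f \<in> S \<and> Via f \<in> H (Src f) (Tgt f)" for f
    by (cases f) (simp add: arr_cat_def Let_def)
  then show ?thesis by blast
qed

lemma Dom_arr_cat: "Dom (arr_cat S H i c) = restrict Src (Mor (arr_cat S H i c))"
  and Cod_arr_cat: "Cod (arr_cat S H i c) = restrict Tgt (Mor (arr_cat S H i c))"
  and Idn_arr_cat: "Idn (arr_cat S H i c) = (\<lambda>X\<in>S. Arr X (i X) X)"
  by (simp_all add: arr_cat_def Let_def)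

lemma Cmp_arr_cat:
  "Cmp (arr_cat S H i c) = (\<lambda>g f. if f \<in> Mor (arr_cat S H i c) \<and> g \<in> Mor (arr_cat S H i c) \<and> Src g = Tgt f
     then Arr (Src f) (c (Src f) (Tgt f) (Tgt g) (Via g) (Via f)) (Tgt g) else undefined)"
  by (simp add: arr_cat_def Let_def)

lemma composable_arr_cat:
  "composable (arr_cat S H i c) g f \<longleftrightarrow>
     f \<in> Mor (arr_cat S H i c) \<and> g \<in> Mor (arr_cat S H i c) \<and> Src g = Tgt f"
  by (auto simp: composable_def Dom_arr_cat Cod_arr_cat)

text \<open>Every arrow carries its endpoints, so composability is equality of tags and each
  category axiom reduces to a law about data in fixed hom sets.\<close>

lemma category_arr_cat:
  assumes i: "\<And>X. X \<in> S \<Longrightarrow> i X \<in> H X X"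
    and c: "\<And>X Y Z a b. \<lbrakk>X \<in> S; Y \<in> S; Z \<in> S; a \<in> H X Y; b \<in> H Y Z\<rbrakk> \<Longrightarrow> c X Y Z b a \<in> H X Z"
    and unit_right: "\<And>X Y a. \<lbrakk>X \<in> S; Y \<in> S; a \<in> H X Y\<rbrakk> \<Longrightarrow> c X X Y a (i X) = a"
    and unit_left: "\<And>X Y a. \<lbrakk>X \<in> S; Y \<in> S; a \<in> H X Y\<rbrakk> \<Longrightarrow> c X Y Y (i Y) a = a"
    and assoc: "\<And>W X Y Z a b d. \<lbrakk>W \<in> S; X \<in> S; Y \<in> S; Z \<in> S; a \<in> H W X; b \<in> H X Y; d \<in> H Y Z\<rbrakk>
      \<Longrightarrow> c W Y Z d (c W X Y b a) = c W X Z (c X Y Z d b) a"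
  shows "category (arr_cat S H i c)"
proof
  show "Dom (arr_cat S H i c) \<in> Mor (arr_cat S H i c) \<rightarrow>\<^sub>E Ob (arr_cat S H i c)"
    "Cod (arr_cat S H i c) \<in> Mor (arr_cat S H i c) \<rightarrow>\<^sub>E Ob (arr_cat S H i c)"
    by (auto simp: Dom_arr_cat Cod_arr_cat Mor_arr_cat)
  show "Idn (arr_cat S H i c) \<in> (\<Pi>\<^sub>E X\<in>Ob (arr_cat S H i c). Hom (arr_cat S H i c) X X)"
    by (auto simp: Idn_arr_cat Hom_def Dom_arr_cat Cod_arr_cat Mor_arr_cat i)
next
  fix f assume "f \<in> Mor (arr_cat S H i c)"
  then show
    "Cmp (arr_cat S H i c) f (Idn (arr_cat S H i c) (Dom (arr_cat S H i c) f)) = f"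
    "Cmp (arr_cat S H i c) (Idn (arr_cat S H i c) (Cod (arr_cat S H i c) f)) f = f"
    by (auto simp: Cmp_arr_cat Idn_arr_cat Dom_arr_cat Cod_arr_cat Mor_arr_cat i unit_right unit_left)
next
  fix g f assume gf: "composable (arr_cat S H i c) g f"
  then show "Cmp (arr_cat S H i c) g f
      \<in> Hom (arr_cat S H i c) (Dom (arr_cat S H i c) f) (Cod (arr_cat S H i c) g)"
    by (auto simp: composable_arr_cat Cmp_arr_cat Dom_arr_cat Cod_arr_cat Mor_arr_cat Hom_def intro!: c)
  fix h assume "composable (arr_cat S H i c) h g"
  with gf show "Cmp (arr_cat S H i c) h (Cmp (arr_cat S H i c) g f)
      = Cmp (arr_cat S H i c) (Cmp (arr_cat S H i c) h g) f"
    by (auto simp: composable_arr_cat Cmp_arr_cat Mor_arr_cat intro: c assoc)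
qed (auto simp: composable_arr_cat Cmp_arr_cat)

text \<open>A literal equality of records: both sides are \<open>undefined\<close> off the same
  domains. It turns the subcategory of \<open>Rel1\<close> back into an \<open>arr_cat\<close>, to
  which \<open>isomorphic_arr_cats\<close> applies.\<close>

lemma full_subcat_arr_cat: "full_subcat (arr_cat S H i c) T = arr_cat (S \<inter> T) H i c"
proof -
  let ?C = "arr_cat S H i c" and ?D = "arr_cat (S \<inter> T) H i c"
  have M: "{f \<in> Mor ?C. Dom ?C f \<in> T \<and> Cod ?C f \<in> T} = Mor ?D"
    by (auto simp: Dom_arr_cat Cod_arr_cat Mor_arr_cat)
  have sub: "f \<in> Mor ?D \<Longrightarrow> f \<in> Mor ?C" for f
    by (simp add: Mor_arr_cat)
  show ?thesis
    unfolding full_subcat_def M Let_def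
    by (rule cat.equality)
      (auto simp: Dom_arr_cat Cod_arr_cat Idn_arr_cat Cmp_arr_cat fun_eq_iff restrict_def sub)
qed

section \<open>Transporting a category along a bijection\<close>

text \<open>That \<open>D\<close> is a category is part of the conclusion: every object, morphism
  and composable pair of \<open>D\<close> comes from one of \<open>C\<close>, so the axioms are
  inherited. The premises about \<open>extensional\<close> and \<open>undefined\<close> supply what
  the locale \<open>category\<close> demands off the domains.\<close>

lemma isomorphic_cats_transport:
  assumes C: "category C"
    and ob: "bij_betw p (Ob C) (Ob D)"
    and mo: "bij_betw q (Mor C) (Mor D)"
    and dom: "\<And>f. f \<in> Mor C \<Longrightarrow> Dom D (q f) = p (Dom C f)" "Dom D \<in> extensional (Mor D)"
    and cod: "\<And>f. f \<in> Mor C \<Longrightarrow> Cod D (q f) = p (Cod C f)" "Cod D \<in> extensional (Mor D)"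
    and idn: "\<And>X. X \<in> Ob C \<Longrightarrow> Idn D (p X) = q (Idn C X)" "Idn D \<in> extensional (Ob D)"
    and cmp: "\<And>g f. composable C g f \<Longrightarrow> Cmp D (q g) (q f) = q (Cmp C g f)"
      "\<And>g f. \<not> composable D g f \<Longrightarrow> Cmp D g f = undefined"
  shows "isomorphic_cats C D"
proof -
  interpret C: category C by (rule C)
  have Dom_Ob: "f \<in> Mor C \<Longrightarrow> Dom C f \<in> Ob C" and Cod_Ob: "f \<in> Mor C \<Longrightarrow> Cod C f \<in> Ob C" for f
    using C.Dom C.Cod by auto
  have Idn_Hom: "X \<in> Ob C \<Longrightarrow> Idn C X \<in> Hom C X X" for X
    using C.Idn by auto
  have p_Ob: "X \<in> Ob C \<Longrightarrow> p X \<in> Ob D" for X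
    using ob by (auto simp: bij_betw_def)
  have q_Mor: "f \<in> Mor C \<Longrightarrow> q f \<in> Mor D" for f
    using mo by (auto simp: bij_betw_def)
  have p_eq: "X \<in> Ob C \<Longrightarrow> Y \<in> Ob C \<Longrightarrow> p X = p Y \<longleftrightarrow> X = Y" for X Y
    using ob by (auto simp: bij_betw_def inj_on_def)
  have q_Hom: "f \<in> Hom C X Y \<Longrightarrow> q f \<in> Hom D (p X) (p Y)" for f X Y
    by (auto simp: Hom_def q_Mor dom cod)
  have composable_q: "f \<in> Mor C \<Longrightarrow> g \<in> Mor C \<Longrightarrow> composable D (q g) (q f) \<longleftrightarrow> composable C g f" for f g
    by (simp add: composable_def q_Mor dom cod p_eq Dom_Ob Cod_Ob)
  have ObE: thesis if "Y \<in> Ob D" "\<And>X. X \<in> Ob C \<Longrightarrow> Y = p X \<Longrightarrow> thesis" for Y thesis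
    using that ob by (auto simp: bij_betw_def)
  have MorE: thesis if "g \<in> Mor D" "\<And>f. f \<in> Mor C \<Longrightarrow> g = q f \<Longrightarrow> thesis" for g thesis
    using that mo by (auto simp: bij_betw_def)
  \<comment> \<open>Preimages of a composable pair are composable because \<open>p\<close> is
    injective: equality of \<open>p (Dom C g')\<close> and \<open>p (Cod C f')\<close> descends to
    \<open>C\<close>.\<close>
  have composableE: thesis if "composable D g f"
    "\<And>g' f'. composable C g' f' \<Longrightarrow> f' \<in> Mor C \<Longrightarrow> g' \<in> Mor C \<Longrightarrow> g = q g' \<Longrightarrow> f = q f' \<Longrightarrow> thesis"
    for g f thesis
    using that by (metis MorE composable_def composable_q)
  have Cmp_Hom: "composable C g f \<Longrightarrow> Cmp C g f \<in> Hom C (Dom C f) (Cod C g)" for g f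
    by (rule C.Cmp)
  interpret D: category D
  proof
    show "Dom D \<in> Mor D \<rightarrow>\<^sub>E Ob D" "Cod D \<in> Mor D \<rightarrow>\<^sub>E Ob D"
      using dom cod by (auto simp: PiE_def elim!: MorE intro!: p_Ob Dom_Ob Cod_Ob)
    show "Idn D \<in> (\<Pi>\<^sub>E X\<in>Ob D. Hom D X X)"
      using idn by (auto simp: PiE_def elim!: ObE intro!: q_Hom Idn_Hom)
  next
    fix f assume "f \<in> Mor D"
    then obtain f' where f': "f' \<in> Mor C" "f = q f'" by (rule MorE)
    \<comment> \<open>The premise \<open>cmp(1)\<close> moves only composites of composable pairs,
      so the two identity composites are checked first.\<close>
    then have *: "composable C f' (Idn C (Dom C f'))" "composable C (Idn C (Cod C f')) f'"
      using Idn_Hom[OF Dom_Ob[OF f'(1)]] Idn_Hom[OF Cod_Ob[OF f'(1)]]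
      by (auto simp: composable_def Hom_def)
    from f' show "Cmp D f (Idn D (Dom D f)) = f" "Cmp D (Idn D (Cod D f)) f = f"
      using cmp(1)[OF *(1)] cmp(1)[OF *(2)]
      by (simp_all add: dom cod idn Dom_Ob Cod_Ob C.Cmp_Idn C.Idn_Cmp)
  next
    fix g f assume "composable D g f"
    then obtain g' f' where gf: "composable C g' f'" "f' \<in> Mor C" "g' \<in> Mor C" "g = q g'" "f = q f'"
      by (rule composableE)
    then show "Cmp D g f \<in> Hom D (Dom D f) (Cod D g)"
      by (simp add: cmp dom cod q_Hom Cmp_Hom)
    fix h assume "composable D h g"
    then obtain h' where h: "h' \<in> Mor C" "h = q h'"
      by (auto simp: composable_def elim: MorE)
    with \<open>composable D h g\<close> gf have hg: "composable C h' g'"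
      by (simp add: composable_q)
    have "composable C h' (Cmp C g' f')" "composable C (Cmp C h' g') f'"
      using hg gf(1) Cmp_Hom[OF hg] Cmp_Hom[OF gf(1)] by (auto simp: composable_def Hom_def)
    then show "Cmp D h (Cmp D g f) = Cmp D (Cmp D h g) f"
      using hg gf h by (simp add: cmp C.assoc)
  qed (rule cmp(2))
  define p' where "p' = the_inv_into (Ob C) p"
  define q' where "q' = the_inv_into (Mor C) q"
  have p'_p: "X \<in> Ob C \<Longrightarrow> p' (p X) = X" for X
    using ob by (simp add: p'_def bij_betw_def the_inv_into_f_f)
  have q'_q: "f \<in> Mor C \<Longrightarrow> q' (q f) = f" for f
    using mo by (simp add: q'_def bij_betw_def the_inv_into_f_f)
  \<comment> \<open>Nothing is known about \<open>p\<close>, \<open>q\<close> and their inverses off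
    the domains; the restrictions give the extensional maps required by
    \<open>fmap_between\<close>.\<close>
  define F where "F = \<lparr>ObF = restrict p (Ob C), MorF = restrict q (Mor C)\<rparr>"
  define G where "G = \<lparr>ObF = restrict p' (Ob D), MorF = restrict q' (Mor D)\<rparr>"
  have Cmp_Mor: "composable C g f \<Longrightarrow> Cmp C g f \<in> Mor C" for g f
    using Cmp_Hom by (auto simp: Hom_def)
  have Idn_Mor: "X \<in> Ob C \<Longrightarrow> Idn C X \<in> Mor C" for X
    using Idn_Hom by (auto simp: Hom_def)
  have "is_functor C D F"
    unfolding is_functor_def fmap_between_def F_def
    using C.category_axioms D.category_axioms
    by (auto simp: p_Ob Dom_Ob Cod_Ob q_Hom Hom_def q_Mor dom cod idn cmp Idn_Mor Cmp_Mor)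
      (auto simp: composable_def cmp)
  moreover have "is_functor D C G"
    unfolding is_functor_def
  proof (intro conjI ballI allI impI)
    show "category D" "category C"
      using C.category_axioms D.category_axioms by auto
    show "fmap_between D C G"
      by (auto simp: fmap_between_def G_def Hom_def dom cod p_Ob Dom_Ob Cod_Ob p'_p q'_q elim!: ObE MorE)
  next
    fix Y assume "Y \<in> Ob D"
    then obtain X where "X \<in> Ob C" "Y = p X" by (rule ObE)
    then show "MorF G (Idn D Y) = Idn C (ObF G Y)"
      by (simp add: G_def idn p_Ob q_Mor Idn_Mor p'_p q'_q)
  next
    fix f g assume "composable D g f"
    then obtain g' f' where "composable C g' f'" "f' \<in> Mor C" "g' \<in> Mor C" "g = q g'" "f = q f'"
      by (rule composableE)
    then show "MorF G (Cmp D g f) = Cmp C (MorF G g) (MorF G f)"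
      by (simp add: G_def cmp q_Mor Cmp_Mor q'_q)
  qed
  moreover have "fmap_comp C G F = fmap_id C" "fmap_comp D F G = fmap_id D"
    by (auto simp: fmap_comp_def fmap_id_def F_def G_def p_Ob q_Mor p'_p q'_q fun_eq_iff restrict_def
        elim!: ObE MorE)
  ultimately show ?thesis
    unfolding isomorphic_cats_def by blast
qed

text \<open>The hom-wise bijections glue to one bijection on all morphisms since the tags keep hom
  sets apart: first \<open>p\<close> matches the endpoints, then the relevant \<open>q X Y\<close>
  matches the data.\<close>

lemma isomorphic_arr_cats:
  assumes C: "category (arr_cat S H i c)"
    and p: "bij_betw p S S'"
    and q: "\<And>X Y. X \<in> S \<Longrightarrow> Y \<in> S \<Longrightarrow> bij_betw (q X Y) (H X Y) (H' (p X) (p Y))"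
    and i: "\<And>X. X \<in> S \<Longrightarrow> i' (p X) = q X X (i X)"
    and c: "\<And>X Y Z a b. \<lbrakk>X \<in> S; Y \<in> S; Z \<in> S; a \<in> H X Y; b \<in> H Y Z\<rbrakk>
      \<Longrightarrow> c' (p X) (p Y) (p Z) (q Y Z b) (q X Y a) = q X Z (c X Y Z b a)"
  shows "isomorphic_cats (arr_cat S H i c) (arr_cat S' H' i' c')"
proof (rule isomorphic_cats_transport[OF C, where p = p and
      q = "\<lambda>f. Arr (p (Src f)) (q (Src f) (Tgt f) (Via f)) (p (Tgt f))"])
  let ?C = "arr_cat S H i c" and ?D = "arr_cat S' H' i' c'"
  let ?q = "\<lambda>f. Arr (p (Src f)) (q (Src f) (Tgt f) (Via f)) (p (Tgt f))"
  have p_S: "X \<in> S \<Longrightarrow> p X \<in> S'" for X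
    using p by (auto simp: bij_betw_def)
  have q_H: "X \<in> S \<Longrightarrow> Y \<in> S \<Longrightarrow> a \<in> H X Y \<Longrightarrow> q X Y a \<in> H' (p X) (p Y)" for X Y a
    using q by (auto simp: bij_betw_def)
  have q_Mor: "f \<in> Mor ?C \<Longrightarrow> ?q f \<in> Mor ?D" for f
    by (auto simp: Mor_arr_cat p_S q_H)
  show "bij_betw ?q (Mor ?C) (Mor ?D)"
  proof (rule bij_betw_imageI)
    show "inj_on ?q (Mor ?C)"
    proof (rule inj_onI)
      fix f g assume f: "f \<in> Mor ?C" and g: "g \<in> Mor ?C" and eq: "?q f = ?q g"
      \<comment> \<open>The endpoints must agree before the data are compared, since only then is
        the same bijection \<open>q X Y\<close> applied to both.\<close>
      then have *: "Src f = Src g" "Tgt f = Tgt g"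
        using p by (auto simp: Mor_arr_cat bij_betw_def inj_on_def)
      with f g eq have "Via f = Via g"
        using q[of "Src g" "Tgt g"] by (auto simp: Mor_arr_cat bij_betw_def inj_on_def)
      with * show "f = g" by (simp add: arr.expand)
    qed
    have "g \<in> ?q ` Mor ?C" if g: "g \<in> Mor ?D" for g
    proof -
      from g obtain X Y where XY: "X \<in> S" "Src g = p X" "Y \<in> S" "Tgt g = p Y"
        using p by (auto simp: Mor_arr_cat bij_betw_def)
      with g have "Via g \<in> q X Y ` H X Y"
        using q[of X Y] by (auto simp: Mor_arr_cat bij_betw_def)
      then obtain a where "a \<in> H X Y" "Via g = q X Y a" by blast
      with XY show ?thesis
        by (intro image_eqI[of _ _ "Arr X a Y"]) (auto simp: Mor_arr_cat arr.expand)
    qed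
    with q_Mor show "?q ` Mor ?C = Mor ?D" by blast
  qed
  show "Dom ?D (?q f) = p (Dom ?C f)" "Cod ?D (?q f) = p (Cod ?C f)" if "f \<in> Mor ?C" for f
    using that q_Mor[OF that] by (simp_all add: Dom_arr_cat Cod_arr_cat)
  show "Idn ?D (p X) = ?q (Idn ?C X)" if "X \<in> Ob ?C" for X
    using that by (simp add: Idn_arr_cat p_S i)
  show "Cmp ?D (?q g) (?q f) = ?q (Cmp ?C g f)" if "composable ?C g f" for g f
    using that q_Mor[of f] q_Mor[of g] by (auto simp: composable_arr_cat Cmp_arr_cat)
      (auto simp: Mor_arr_cat c)
  show "Cmp ?D g f = undefined" if "\<not> composable ?D g f" for g f
    using that by (auto simp: composable_arr_cat Cmp_arr_cat)
qed (auto simp: p Dom_arr_cat Cod_arr_cat Idn_arr_cat)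

section \<open>The power categorder\<close>

text \<open>The locale \<open>category\<close> reads only the six fields of \<open>cat\<close>, so
  an order can be attached or dropped freely.\<close>

lemma category_extend: "category (cat.extend K r) \<longleftrightarrow> category K"
  by (simp add: category_def composable_def Hom_def cat.extend_def)

lemma category_truncate: "category (cat.truncate C) \<longleftrightarrow> category C"
  by (simp add: category_def composable_def Hom_def cat.truncate_def)

section \<open>Down closures in a categorder\<close>

context categorder
begin

lemma Dom_Ob: "f \<in> Mor C \<Longrightarrow> Dom C f \<in> Ob C"
  and Cod_Ob: "f \<in> Mor C \<Longrightarrow> Cod C f \<in> Ob C"
  using Dom Cod by auto

lemma Idn_Mor:
  assumes "X \<in> Ob C"
  shows "Idn C X \<in> Mor C" "Dom C (Idn C X) = X" "Cod C (Idn C X) = X"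
  using Idn assms by (auto simp: Hom_def)

lemma Cmp_Mor:
  assumes "composable C g f"
  shows "Cmp C g f \<in> Mor C" "Dom C (Cmp C g f) = Dom C f" "Cod C (Cmp C g f) = Cod C g"
  using Cmp[OF assms] by (auto simp: Hom_def)

lemma Le_refl: "f \<in> Mor C \<Longrightarrow> (f, f) \<in> Le C"
  and Le_trans: "(f, g) \<in> Le C \<Longrightarrow> (g, h) \<in> Le C \<Longrightarrow> (f, h) \<in> Le C"
  and Le_Mor: "(f, g) \<in> Le C \<Longrightarrow> f \<in> Mor C \<and> g \<in> Mor C"
  using order by (auto simp: partial_order_on_def preorder_on_def refl_on_def dest: transD)

lemma mem_Homs: "f \<in> Homs C A B \<longleftrightarrow> f \<in> Mor C \<and> Dom C f \<in> A \<and> Cod C f \<in> B"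
  by (auto simp: Homs_def Hom_def)

text \<open>A morphism below another has the same endpoints, by \<open>parallel\<close>.\<close>

lemma down_subset_Homs: "s \<subseteq> Homs C A B \<Longrightarrow> down C s \<subseteq> Homs C A B"
  using Le_Mor parallel by (fastforce simp: down_def mem_Homs)

lemma down_down: "down C (down C s) \<subseteq> down C s"
  by (auto simp: down_def intro: Le_trans)

lemma subset_down: "s \<subseteq> Mor C \<Longrightarrow> s \<subseteq> down C s"
  by (auto simp: down_def intro: Le_refl)

end

section \<open>Composition of down closed sets of morphisms\<close>

definition power_comp :: "('o, 'm, 'z) cato_scheme \<Rightarrow> 'm set \<Rightarrow> 'm set \<Rightarrow> 'm set" where
  "power_comp C t s = down C {Cmp C g f | g f. f \<in> s \<and> g \<in> t \<and> composable C g f}"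

text \<open>This is the underlying category of \<open>P1 C\<close> with the inclusion order removed,
  so that the lemmas on \<open>arr_cat\<close> apply.\<close>

definition power_cat :: "('o, 'm, 'z) cato_scheme \<Rightarrow> ('o set, ('o set, 'm set) arr) cat" where
  "power_cat C = arr_cat (Pow (Ob C)) (\<lambda>A B. {s. s \<subseteq> Homs C A B \<and> down C s \<subseteq> s})
     (\<lambda>A. down C (Idn C ` A)) (\<lambda>_ _ _. power_comp C)"

lemma P1_eq: "P1 C = cat.extend (power_cat C) (cato.fields
    {(s, t). s \<in> Mor (power_cat C) \<and> t \<in> Mor (power_cat C) \<and>
       Src s = Src t \<and> Tgt s = Tgt t \<and> Via s \<subseteq> Via t})"
  by (simp add: P1_def power_cat_def power_comp_def[abs_def] Let_def)

lemma Ob_P1: "Ob (P1 C) = Pow (Ob C)"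
  by (simp add: P1_eq cat.defs cato.defs power_cat_def)

lemma Mor_P1: "Mor (P1 C) = {s. Src s \<subseteq> Ob C \<and> Tgt s \<subseteq> Ob C \<and>
    Via s \<subseteq> Homs C (Src s) (Tgt s) \<and> down C (Via s) \<subseteq> Via s}"
  by (simp add: P1_eq cat.defs cato.defs power_cat_def Mor_arr_cat)

lemma Dom_P1: "s \<in> Mor (P1 C) \<Longrightarrow> Dom (P1 C) s = Src s"
  and Cod_P1: "s \<in> Mor (P1 C) \<Longrightarrow> Cod (P1 C) s = Tgt s"
  and Idn_P1: "A \<subseteq> Ob C \<Longrightarrow> Idn (P1 C) A = Arr A (down C (Idn C ` A)) A"
  by (simp_all add: P1_eq cat.defs cato.defs power_cat_def Dom_arr_cat Cod_arr_cat Idn_arr_cat)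

lemma composable_P1:
  "composable (P1 C) t s \<longleftrightarrow> s \<in> Mor (P1 C) \<and> t \<in> Mor (P1 C) \<and> Src t = Tgt s"
  by (auto simp: composable_def Dom_P1 Cod_P1)

lemma Cmp_P1: "composable (P1 C) t s \<Longrightarrow>
    Cmp (P1 C) t s = Arr (Src s) (power_comp C (Via t) (Via s)) (Tgt t)"
  by (simp add: composable_P1) (simp add: P1_eq cat.defs cato.defs power_cat_def Cmp_arr_cat)

lemma Le_P1: "Le (P1 C) = {(s, t). s \<in> Mor (P1 C) \<and> t \<in> Mor (P1 C) \<and>
    Src s = Src t \<and> Tgt s = Tgt t \<and> Via s \<subseteq> Via t}"
  by (simp add: P1_eq cat.defs cato.defs)

lemma Hom_P1: "s \<in> Hom (P1 C) A B \<longleftrightarrow> s \<in> Mor (P1 C) \<and> Src s = A \<and> Tgt s = B"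
  by (auto simp: Hom_def Dom_P1 Cod_P1)

lemma mem_power_comp: "h \<in> power_comp C t s \<longleftrightarrow>
    (\<exists>g\<in>t. \<exists>f\<in>s. composable C g f \<and> (h, Cmp C g f) \<in> Le C)"
  by (auto simp: power_comp_def down_def)

lemma power_comp_mono: "t \<subseteq> t' \<Longrightarrow> s \<subseteq> s' \<Longrightarrow> power_comp C t s \<subseteq> power_comp C t' s'"
  unfolding mem_power_comp subset_iff by blast

text \<open>Composing \<open>g\<close> with something below an identity gives something below
  \<open>g\<close> by \<open>Cmp_mono\<close>, hence stays in the down closed \<open>s\<close>.
  Conversely each \<open>h\<close> in \<open>s\<close> is its own composite with an
  identity.\<close>

lemma (in categorder) power_comp_Idn:
  assumes s: "s \<subseteq> Homs C A B" "down C s \<subseteq> s" and A: "A \<subseteq> Ob C"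
  shows "power_comp C s (down C (Idn C ` A)) = s"
proof (intro equalityI subsetI)
  fix h assume "h \<in> power_comp C s (down C (Idn C ` A))"
  then obtain g f X where *: "g \<in> s" "X \<in> A" "(f, Idn C X) \<in> Le C" "composable C g f"
      "(h, Cmp C g f) \<in> Le C"
    by (auto simp: mem_power_comp down_def)
  \<comment> \<open>Being below \<open>Idn C X\<close>, the morphism \<open>f\<close> is an
    endomorphism of \<open>X\<close>, so \<open>g\<close> starts at \<open>X\<close>.\<close>
  with A s have g: "g \<in> Mor C" "Dom C g = X" "composable C g (Idn C X)"
    using parallel[OF *(3)] by (auto simp: composable_def Idn_Mor mem_Homs subset_iff)
  with * have "(Cmp C g f, Cmp C g (Idn C X)) \<in> Le C"
    by (intro Cmp_mono Le_refl)
  with g * have "(h, g) \<in> Le C"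
    using Cmp_Idn[of g] by (auto intro: Le_trans)
  with * s show "h \<in> s" by (auto simp: down_def)
next
  fix h assume "h \<in> s"
  with s A have "h \<in> Mor C" "Dom C h \<in> A" "Dom C h \<in> Ob C" by (auto simp: mem_Homs subset_iff)
  then have "Idn C (Dom C h) \<in> down C (Idn C ` A)" "composable C h (Idn C (Dom C h))"
      "(h, Cmp C h (Idn C (Dom C h))) \<in> Le C"
    by (auto simp: down_def composable_def Idn_Mor Cmp_Idn intro!: Le_refl bexI)
  with \<open>h \<in> s\<close> show "h \<in> power_comp C s (down C (Idn C ` A))"
    by (auto simp: mem_power_comp)
qed

text \<open>The mirror image of \<open>power_comp_Idn\<close>, with identities at the
  codomain.\<close>

lemma (in categorder) Idn_power_comp:
  assumes s: "s \<subseteq> Homs C A B" "down C s \<subseteq> s" and B: "B \<subseteq> Ob C"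
  shows "power_comp C (down C (Idn C ` B)) s = s"
proof (intro equalityI subsetI)
  fix h assume "h \<in> power_comp C (down C (Idn C ` B)) s"
  then obtain g f X where *: "f \<in> s" "X \<in> B" "(g, Idn C X) \<in> Le C" "composable C g f"
      "(h, Cmp C g f) \<in> Le C"
    by (auto simp: mem_power_comp down_def)
  with B s have f: "f \<in> Mor C" "Cod C f = X" "composable C (Idn C X) f"
    using parallel[OF *(3)] by (auto simp: composable_def Idn_Mor mem_Homs subset_iff)
  with * have "(Cmp C g f, Cmp C (Idn C X) f) \<in> Le C"
    by (intro Cmp_mono Le_refl)
  with f * have "(h, f) \<in> Le C"
    using Idn_Cmp[of f] by (auto intro: Le_trans)
  with * s show "h \<in> s" by (auto simp: down_def)
next
  fix h assume "h \<in> s"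
  with s B have "h \<in> Mor C" "Cod C h \<in> B" "Cod C h \<in> Ob C" by (auto simp: mem_Homs subset_iff)
  then have "Idn C (Cod C h) \<in> down C (Idn C ` B)" "composable C (Idn C (Cod C h)) h"
      "(h, Cmp C (Idn C (Cod C h)) h) \<in> Le C"
    by (auto simp: down_def composable_def Idn_Mor Idn_Cmp intro!: Le_refl bexI)
  with \<open>h \<in> s\<close> show "h \<in> power_comp C (down C (Idn C ` B)) s"
    by (auto simp: mem_power_comp)
qed

text \<open>Both sides consist of the morphisms below some triple composite: the inner down closure
  contributes an approximation \<open>y\<close>, which monotonicity of composition lets the outer
  down closure absorb.\<close>

lemma (in categorder) power_comp_assoc:
  "power_comp C u (power_comp C t s) = power_comp C (power_comp C u t) s"
proof (intro equalityI subsetI)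
  fix k assume "k \<in> power_comp C u (power_comp C t s)"
  then obtain h y g f where *: "h \<in> u" "g \<in> t" "f \<in> s" "composable C g f" "composable C h y"
      "(y, Cmp C g f) \<in> Le C" "(k, Cmp C h y) \<in> Le C"
    by (auto simp: mem_power_comp)
  \<comment> \<open>As \<open>y\<close> is parallel to \<open>Cmp C g f\<close>, whatever composes
    with \<open>y\<close> also composes with \<open>Cmp C g f\<close>, and so with
    \<open>g\<close>.\<close>
  then have hg: "composable C h g" "composable C h (Cmp C g f)"
    using parallel[OF *(6)] Cmp_Mor[OF *(4)] by (auto simp: composable_def)
  then have "(Cmp C h y, Cmp C h (Cmp C g f)) \<in> Le C"
    using * by (intro Cmp_mono) (auto simp: composable_def intro: Le_refl)
  with * hg have "(k, Cmp C (Cmp C h g) f) \<in> Le C" "composable C (Cmp C h g) f"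
    using Cmp_Mor[OF hg(1)] by (auto simp: assoc composable_def intro: Le_trans)
  moreover have "Cmp C h g \<in> power_comp C u t"
    using *(1,2) hg(1) Cmp_Mor(1)[OF hg(1)] unfolding mem_power_comp by (blast intro: Le_refl)
  ultimately show "k \<in> power_comp C (power_comp C u t) s"
    using *(3) unfolding mem_power_comp[where h = k] by blast
next
  fix k assume "k \<in> power_comp C (power_comp C u t) s"
  then obtain h y g f where *: "h \<in> u" "g \<in> t" "f \<in> s" "composable C h g" "composable C y f"
      "(y, Cmp C h g) \<in> Le C" "(k, Cmp C y f) \<in> Le C"
    by (auto simp: mem_power_comp)
  then have gf: "composable C g f" "composable C (Cmp C h g) f"
    using parallel[OF *(6)] Cmp_Mor[OF *(4)] by (auto simp: composable_def)
  then have "(Cmp C y f, Cmp C (Cmp C h g) f) \<in> Le C"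
    using * by (intro Cmp_mono) (auto simp: composable_def intro: Le_refl)
  with * gf have "(k, Cmp C h (Cmp C g f)) \<in> Le C" "composable C h (Cmp C g f)"
    using Cmp_Mor[OF gf(1)] by (auto simp: assoc composable_def intro: Le_trans)
  moreover have "Cmp C g f \<in> power_comp C t s"
    using *(2,3) gf(1) Cmp_Mor(1)[OF gf(1)] unfolding mem_power_comp by (blast intro: Le_refl)
  ultimately show "k \<in> power_comp C u (power_comp C t s)"
    using *(1) unfolding mem_power_comp[where h = k] by blast
qed

lemma (in categorder) category_power_cat: "category (power_cat C)"
  unfolding power_cat_def
proof (rule category_arr_cat)
  fix A assume "A \<in> Pow (Ob C)"
  then have "Idn C ` A \<subseteq> Homs C A A"
    by (auto simp: mem_Homs Idn_Mor subset_iff)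
  then show "down C (Idn C ` A) \<in> {s. s \<subseteq> Homs C A A \<and> down C s \<subseteq> s}"
    using down_subset_Homs down_down by auto
next
  fix A B B' s t
  assume "s \<in> {s. s \<subseteq> Homs C A B \<and> down C s \<subseteq> s}" "t \<in> {s. s \<subseteq> Homs C B B' \<and> down C s \<subseteq> s}"
  then have "{Cmp C g f |g f. f \<in> s \<and> g \<in> t \<and> composable C g f} \<subseteq> Homs C A B'"
    by (auto simp: mem_Homs Cmp_Mor subset_iff)
  then show "power_comp C t s \<in> {s. s \<subseteq> Homs C A B' \<and> down C s \<subseteq> s}"
    unfolding power_comp_def using down_subset_Homs down_down by auto
qed (auto simp: power_comp_Idn Idn_power_comp power_comp_assoc)

text \<open>Antisymmetry holds because the tags and \<open>Via\<close> determine an arrow;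
  composition is monotone because \<open>power_comp\<close> is monotone in both arguments.\<close>

lemma categorder_P1:
  assumes "categorder C"
  shows "categorder (P1 C)"
proof -
  interpret C: categorder C by (rule assms)
  interpret P: category "P1 C"
    unfolding P1_eq category_extend by (rule C.category_power_cat)
  show ?thesis
  proof
    show "partial_order_on (Mor (P1 C)) (Le (P1 C))"
      by (auto simp: partial_order_on_def preorder_on_def refl_on_def trans_def antisym_def Le_P1
          intro: arr.expand)
    show "Dom (P1 C) f = Dom (P1 C) g \<and> Cod (P1 C) f = Cod (P1 C) g" if "(f, g) \<in> Le (P1 C)" for f g
      using that by (auto simp: Le_P1 Dom_P1 Cod_P1)
    show "(Cmp (P1 C) g f, Cmp (P1 C) g' f') \<in> Le (P1 C)"
      if "composable (P1 C) g f" "composable (P1 C) g' f'" "(f, f') \<in> Le (P1 C)" "(g, g') \<in> Le (P1 C)"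
      for g f g' f'
    proof -
      \<comment> \<open>Inclusion alone does not give \<open>Le (P1 C)\<close>: both sides must also
        be morphisms.\<close>
      have "Cmp (P1 C) g f \<in> Mor (P1 C)" "Cmp (P1 C) g' f' \<in> Mor (P1 C)"
        using that(1,2) P.Cmp by (auto simp: Hom_def)
      then show ?thesis
        using that by (simp add: Le_P1 Cmp_P1 power_comp_mono)
    qed
  qed
qed

section \<open>Kleisli extension along the multiplication\<close>

lemma fmap_between_P1:
  "fmap_between C (P1 D) F \<longleftrightarrow> ObF F \<in> Ob C \<rightarrow>\<^sub>E Pow (Ob D) \<and> MorF F \<in> extensional (Mor C) \<and>
     (\<forall>f\<in>Mor C. MorF F f \<in> Mor (P1 D) \<and>
        Src (MorF F f) = ObF F (Dom C f) \<and> Tgt (MorF F f) = ObF F (Cod C f))"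
  by (auto simp: fmap_between_def Ob_P1 PiE_def Pi_def Hom_P1)

text \<open>An arrow added by the down closure has its \<open>Via\<close> inside some
  \<open>Via (MorF G d)\<close>, so it adds nothing to the union. Since \<open>mu\<close> is
  \<open>undefined\<close> off \<open>Mor (P1 (P1 E))\<close>, the main work is to show that the
  intermediate arrow lies there.\<close>

lemma Kleisli_extension:
  assumes "functorder D (P1 E) G"
  shows "A \<subseteq> Ob D \<Longrightarrow> ObF (mu E) (ObF (P1_map D (P1 E) G) A) = (\<Union>Y\<in>A. ObF G Y)"
    and "s \<in> Mor (P1 D) \<Longrightarrow> MorF (mu E) (MorF (P1_map D (P1 E) G) s) =
      Arr (\<Union>Y\<in>Src s. ObF G Y) (\<Union>d\<in>Via s. Via (MorF G d)) (\<Union>Y\<in>Tgt s. ObF G Y)"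
proof -
  interpret D: categorder D using assms by (simp add: functorder_def)
  interpret PE: categorder "P1 E" using assms by (simp add: functorder_def)
  have ob: "Y \<in> Ob D \<Longrightarrow> ObF G Y \<in> Ob (P1 E)" for Y
    using assms by (auto simp: functorder_def fmap_between_P1 Ob_P1)
  have mor: "d \<in> Mor D \<Longrightarrow> MorF G d \<in> Hom (P1 E) (ObF G (Dom D d)) (ObF G (Cod D d))" for d
    using assms by (auto simp: functorder_def fmap_between_def)
  show "ObF (mu E) (ObF (P1_map D (P1 E) G) A) = (\<Union>Y\<in>A. ObF G Y)" if "A \<subseteq> Ob D"
  proof -
    have "ObF G ` A \<subseteq> Ob (P1 E)" using that ob by blast
    then show ?thesis
      using that by (simp add: mu_def P1_map_def Ob_P1)
  qed
  assume s: "s \<in> Mor (P1 D)"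
  \<comment> \<open>The images have endpoints in the claimed object sets, and passing to the down
    closure preserves this; hence membership in \<open>Mor (P1 (P1 E))\<close>.\<close>
  have "MorF G d \<in> Homs (P1 E) (ObF G ` Src s) (ObF G ` Tgt s)" if "d \<in> Via s" for d
  proof -
    from s that have "d \<in> Mor D" "Dom D d \<in> Src s" "Cod D d \<in> Tgt s"
      by (auto simp: Mor_P1 D.mem_Homs)
    with mor[of d] show ?thesis
      by (auto simp: PE.mem_Homs Hom_def)
  qed
  then have "MorF G ` Via s \<subseteq> Homs (P1 E) (ObF G ` Src s) (ObF G ` Tgt s)"
    by blast
  then have sub: "down (P1 E) (MorF G ` Via s) \<subseteq> Homs (P1 E) (ObF G ` Src s) (ObF G ` Tgt s)"
    by (rule PE.down_subset_Homs)
  moreover have "ObF G ` Src s \<subseteq> Ob (P1 E)" "ObF G ` Tgt s \<subseteq> Ob (P1 E)"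
    using s ob by (auto simp: Mor_P1)
  ultimately have "MorF (P1_map D (P1 E) G) s \<in> Mor (P1 (P1 E))"
    using s PE.down_down by (simp add: P1_map_def Mor_P1[of "P1 E"])
  moreover have "\<Union> (Via ` down (P1 E) (MorF G ` Via s)) = (\<Union>d\<in>Via s. Via (MorF G d))"
  proof
    show "\<Union> (Via ` down (P1 E) (MorF G ` Via s)) \<subseteq> (\<Union>d\<in>Via s. Via (MorF G d))"
      by (auto simp: down_def Le_P1)
    have "MorF G ` Via s \<subseteq> Mor (P1 E)"
      using s mor by (auto simp: Mor_P1[of D] D.mem_Homs Hom_def)
    then show "(\<Union>d\<in>Via s. Via (MorF G d)) \<subseteq> \<Union> (Via ` down (P1 E) (MorF G ` Via s))"
      using PE.subset_down by blast
  qed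
  ultimately show "MorF (mu E) (MorF (P1_map D (P1 E) G) s) =
      Arr (\<Union>Y\<in>Src s. ObF G Y) (\<Union>d\<in>Via s. Via (MorF G d)) (\<Union>Y\<in>Tgt s. ObF G Y)"
    using s by (simp add: mu_def P1_map_def)
qed

section \<open>Partial multivalued functors\<close>

definition pmv_id :: "('o, 'm, 'z) cat_scheme \<Rightarrow> ('o, 'm, 'o set, 'm set) fmap" where
  "pmv_id C = \<lparr>ObF = (\<lambda>X\<in>Ob C. {X}), MorF = (\<lambda>f\<in>Mor C. {f})\<rparr>"

definition pmv_comp :: "('o, 'm, 'z) cat_scheme \<Rightarrow> ('p, 'n, 'q set, 'k set) fmap
    \<Rightarrow> ('o, 'm, 'p set, 'n set) fmap \<Rightarrow> ('o, 'm, 'q set, 'k set) fmap" where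
  "pmv_comp C G F = \<lparr>ObF = (\<lambda>X\<in>Ob C. \<Union>Y\<in>ObF F X. ObF G Y),
     MorF = (\<lambda>f\<in>Mor C. \<Union>d\<in>MorF F f. MorF G d)\<rparr>"

lemma Cat_pmv_eq: "Cat_pmv = arr_cat {C. category C} (\<lambda>C D. {F. pmv_functor C D F})
    pmv_id (\<lambda>C D E. pmv_comp C)"
  by (simp add: Cat_pmv_def pmv_id_def[abs_def] pmv_comp_def[abs_def])

lemma pmv_functor_ObD: "pmv_functor C D F \<Longrightarrow> X \<in> Ob C \<Longrightarrow> ObF F X \<subseteq> Ob D"
  and pmv_functor_MorD: "pmv_functor C D F \<Longrightarrow> f \<in> Mor C \<Longrightarrow>
    MorF F f \<subseteq> Homs D (ObF F (Dom C f)) (ObF F (Cod C f))"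
  and pmv_functor_Mor_subset: "pmv_functor C D F \<Longrightarrow> f \<in> Mor C \<Longrightarrow> MorF F f \<subseteq> Mor D"
  and pmv_functor_ext: "pmv_functor C D F \<Longrightarrow> ObF F \<in> extensional (Ob C) \<and> MorF F \<in> extensional (Mor C)"
  by (auto simp: pmv_functor_def Homs_def Hom_def PiE_iff)

lemma pmv_functor_id:
  assumes "category C"
  shows "pmv_functor C C (pmv_id C)"
proof -
  interpret category C by (rule assms)
  have "f \<in> Mor C \<Longrightarrow> Dom C f \<in> Ob C \<and> Cod C f \<in> Ob C" for f using Dom Cod by auto
  moreover have "X \<in> Ob C \<Longrightarrow> Idn C X \<in> Mor C" for X using Idn by (auto simp: Hom_def)
  moreover have "composable C g f \<Longrightarrow> Cmp C g f \<in> Mor C" for g f using Cmp by (auto simp: Hom_def)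
  moreover have "composable C g f \<Longrightarrow> g \<in> Mor C \<and> f \<in> Mor C" for g f by (simp add: composable_def)
  ultimately show ?thesis
    using assms by (auto simp: pmv_functor_def pmv_id_def Homs_def Hom_def)
qed

text \<open>For (i) and (ii), an element \<open>e\<close> of the composite's value lies in
  \<open>MorF G d\<close> for some \<open>d\<close> in the value of \<open>F\<close>. The condition
  for \<open>F\<close> rewrites \<open>d\<close>, and then the condition for \<open>G\<close>
  rewrites \<open>e\<close>.\<close>

lemma pmv_functor_comp:
  assumes F: "pmv_functor C D F" and G: "pmv_functor D E G"
  shows "pmv_functor C E (pmv_comp C G F)"
proof -
  interpret C: category C using F by (simp add: pmv_functor_def)
  have Ob: "f \<in> Mor C \<Longrightarrow> Dom C f \<in> Ob C \<and> Cod C f \<in> Ob C" for f using C.Dom C.Cod by auto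
  have Idn: "X \<in> Ob C \<Longrightarrow> Idn C X \<in> Mor C" for X using C.Idn by (auto simp: Hom_def)
  have Cmp: "composable C g f \<Longrightarrow> Cmp C g f \<in> Mor C" for g f using C.Cmp by (auto simp: Hom_def)
  have comp: "composable C g f \<Longrightarrow> g \<in> Mor C \<and> f \<in> Mor C" for g f by (simp add: composable_def)
  show ?thesis
    unfolding pmv_functor_def
  proof (intro conjI ballI allI impI)
    show "category C" "category E" using F G by (auto simp: pmv_functor_def)
    show "ObF (pmv_comp C G F) \<in> Ob C \<rightarrow>\<^sub>E Pow (Ob E)"
      using pmv_functor_ObD[OF F] pmv_functor_ObD[OF G] by (fastforce simp: pmv_comp_def)
    have "(\<Union>d\<in>MorF F f. MorF G d) \<subseteq>
        Homs E (\<Union>Y\<in>ObF F (Dom C f). ObF G Y) (\<Union>Y\<in>ObF F (Cod C f). ObF G Y)" if "f \<in> Mor C" for f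
    proof
      fix e assume "e \<in> (\<Union>d\<in>MorF F f. MorF G d)"
      then obtain d where d: "d \<in> MorF F f" "e \<in> MorF G d" by blast
      then have "d \<in> Homs D (ObF F (Dom C f)) (ObF F (Cod C f))" "d \<in> Mor D"
        using pmv_functor_MorD[OF F that] pmv_functor_Mor_subset[OF F that] by auto
      with d pmv_functor_MorD[OF G, of d]
      show "e \<in> Homs E (\<Union>Y\<in>ObF F (Dom C f). ObF G Y) (\<Union>Y\<in>ObF F (Cod C f). ObF G Y)"
        by (fastforce simp: Homs_def Hom_def)
    qed
    then show "MorF (pmv_comp C G F) \<in> (\<Pi>\<^sub>E f\<in>Mor C.
        Pow (Homs E (ObF (pmv_comp C G F) (Dom C f)) (ObF (pmv_comp C G F) (Cod C f))))"
      by (auto simp: pmv_comp_def Ob)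
  next
    fix X e assume X: "X \<in> Ob C" and "e \<in> MorF (pmv_comp C G F) (Idn C X)"
    then obtain d where d: "d \<in> MorF F (Idn C X)" "e \<in> MorF G d"
      by (auto simp: pmv_comp_def Idn)
    from F X d(1) obtain Y where Y: "Y \<in> ObF F X" "d = Idn D Y"
      unfolding pmv_functor_def by blast
    with X have "Y \<in> Ob D" using pmv_functor_ObD[OF F] by auto
    with G d Y obtain Z where "Z \<in> ObF G Y" "e = Idn E Z"
      unfolding pmv_functor_def by blast
    with X Y show "\<exists>Z\<in>ObF (pmv_comp C G F) X. e = Idn E Z"
      by (auto simp: pmv_comp_def)
  next
    fix f g e assume gf: "composable C g f" and "e \<in> MorF (pmv_comp C G F) (Cmp C g f)"
    then obtain d where d: "d \<in> MorF F (Cmp C g f)" "e \<in> MorF G d"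
      by (auto simp: pmv_comp_def Cmp)
    with F gf obtain d1 d2 where d12: "d1 \<in> MorF F f" "d2 \<in> MorF F g" "composable D d2 d1"
        "d = Cmp D d2 d1"
      unfolding pmv_functor_def by blast
    with G d obtain e1 e2 where "e1 \<in> MorF G d1" "e2 \<in> MorF G d2" "composable E e2 e1"
        "e = Cmp E e2 e1"
      unfolding pmv_functor_def by blast
    with d12 comp[OF gf]
    show "\<exists>e1\<in>MorF (pmv_comp C G F) f. \<exists>e2\<in>MorF (pmv_comp C G F) g.
        composable E e2 e1 \<and> e = Cmp E e2 e1"
      by (auto simp: pmv_comp_def)
  qed
qed

text \<open>The laws are identities between unions. They hold on the domains because the values of a
  partial multivalued functor lie where the next restricted map is evaluated, and off the domains
  because all maps are extensional.\<close>

lemma category_Cat_pmv: "category Cat_pmv"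
  unfolding Cat_pmv_eq
proof (rule category_arr_cat; clarsimp simp: pmv_functor_id pmv_functor_comp)
  fix C D :: "('o, 'm) cat" and F :: "('o, 'm) pmv_map"
  assume F: "pmv_functor C D F"
  show "pmv_comp C F (pmv_id C) = F"
    using pmv_functor_ext[OF F]
    by (intro fmap.equality) (auto simp: pmv_comp_def pmv_id_def extensional_def fun_eq_iff)
  show "pmv_comp C (pmv_id D) F = F"
  proof (rule fmap.equality)
    \<comment> \<open>Each \<open>Y\<close> in \<open>ObF F X\<close> is an object of
      \<open>D\<close>, so \<open>pmv_id D\<close> yields the singleton of \<open>Y\<close> instead
      of \<open>undefined\<close>.\<close>
    have "(\<Union>Y\<in>ObF F X. ObF (pmv_id D) Y) = ObF F X" if "X \<in> Ob C" for X
      using pmv_functor_ObD[OF F that] by (auto simp: pmv_id_def subset_iff split: if_splits)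
    then show "ObF (pmv_comp C (pmv_id D) F) = ObF F"
      using pmv_functor_ext[OF F] by (auto simp: pmv_comp_def extensional_def fun_eq_iff)
    have "(\<Union>d\<in>MorF F f. MorF (pmv_id D) d) = MorF F f" if "f \<in> Mor C" for f
      using pmv_functor_Mor_subset[OF F that] by (auto simp: pmv_id_def subset_iff split: if_splits)
    then show "MorF (pmv_comp C (pmv_id D) F) = MorF F"
      using pmv_functor_ext[OF F] by (auto simp: pmv_comp_def extensional_def fun_eq_iff)
  qed simp
next
  fix B C D E :: "('o, 'm) cat" and F G K :: "('o, 'm) pmv_map"
  assume F: "pmv_functor B C F" and G: "pmv_functor C D G"
  show "pmv_comp B K (pmv_comp B G F) = pmv_comp B (pmv_comp C K G) F"
    using pmv_functor_ObD[OF F] pmv_functor_Mor_subset[OF F]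
    by (simp add: pmv_comp_def subset_iff cong: restrict_cong SUP_cong)
qed

section \<open>Categories as discrete categorders\<close>

text \<open>Equality is cut down to \<open>Mor C\<close>, since the order of a categorder relates
  morphisms only.\<close>

definition disc :: "('o, 'm) cat \<Rightarrow> ('o, 'm) cato" where
  "disc C = cat.extend C (cato.fields (Id_on (Mor C)))"

lemma disc_simps [simp]:
  "Ob (disc C) = Ob C" "Mor (disc C) = Mor C" "Dom (disc C) = Dom C" "Cod (disc C) = Cod C"
  "Idn (disc C) = Idn C" "Cmp (disc C) = Cmp C" "Le (disc C) = Id_on (Mor C)"
  by (simp_all add: disc_def cat.defs cato.defs)

lemma composable_disc [simp]: "composable (disc C) = composable C"
  by (simp add: composable_def fun_eq_iff)

lemma Homs_disc [simp]: "Homs (disc C) = Homs C"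
  by (simp add: Homs_def Hom_def fun_eq_iff)

lemma down_disc: "down (disc C) s = s \<inter> Mor C"
  by (auto simp: down_def)

lemma categorder_disc:
  assumes "category C"
  shows "categorder (disc C)"
proof -
  interpret category "disc C"
    using assms unfolding disc_def category_extend .
  show ?thesis
    by unfold_locales
      (use Cmp in \<open>auto simp: partial_order_on_def preorder_on_def refl_on_def trans_def antisym_def Hom_def\<close>)
qed

text \<open>The predicate \<open>discrete\<close> fixes \<open>Le C\<close> on pairs of morphisms,
  and a categorder has no other related pairs, so the order is recovered exactly.\<close>

lemma disc_truncate:
  assumes "categorder C" "discrete C"
  shows "disc (cat.truncate C) = C"
proof (rule cato.equality)
  interpret categorder C by (rule assms)
  have "(f, g) \<in> Le C \<longleftrightarrow> f = g \<and> f \<in> Mor C" for f g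
    using assms(2) Le_Mor[of f g] unfolding discrete_def by blast
  then show "Le (disc (cat.truncate C)) = Le C"
    by (auto simp: cat.defs)
qed (simp_all add: cat.defs)

text \<open>The object part of the isomorphism; forgetting the order is the inverse.\<close>

lemma bij_betw_disc:
  "bij_betw disc {C. category C} ({C :: ('o, 'm) cato. categorder C} \<inter> {C. discrete C})"
proof (rule bij_betw_byWitness[where f' = cat.truncate])
  show "\<forall>C\<in>{C. category C}. cat.truncate (disc C) = C"
    by (auto intro!: cat.equality simp: cat.defs disc_def)
  show "disc ` {C. category C} \<subseteq> {C. categorder C} \<inter> {C. discrete C}"
    by (auto simp: categorder_disc discrete_def)
  show "\<forall>C\<in>{C. categorder C} \<inter> {C. discrete C}. disc (cat.truncate C) = C"
    by (simp add: disc_truncate)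
  show "cat.truncate ` ({C. categorder C} \<inter> {C. discrete C}) \<subseteq> {C. category C}"
    by (auto simp: category_truncate categorder_def)
qed

section \<open>Partial multivalued functors as functorders into the power categorder\<close>

definition pmv_to_rel :: "('o, 'm, 'z) cat_scheme \<Rightarrow> ('o, 'm, 'p set, 'n set) fmap
    \<Rightarrow> ('o, 'm, 'p set, ('p set, 'n set) arr) fmap" where
  "pmv_to_rel C F = \<lparr>ObF = ObF F,
     MorF = (\<lambda>f\<in>Mor C. Arr (ObF F (Dom C f)) (MorF F f) (ObF F (Cod C f)))\<rparr>"

text \<open>Forgets the tags that \<open>pmv_to_rel\<close> adds; for a functorder they can be
  recovered from \<open>ObF\<close>.\<close>

definition rel_to_pmv :: "('o, 'm, 'z) cat_scheme \<Rightarrow> ('o, 'm, 'p set, ('p set, 'n set) arr) fmap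
    \<Rightarrow> ('o, 'm, 'p set, 'n set) fmap" where
  "rel_to_pmv C F = \<lparr>ObF = ObF F, MorF = (\<lambda>f\<in>Mor C. Via (MorF F f))\<rparr>"

lemma ObF_pmv_to_rel [simp]: "ObF (pmv_to_rel C F) = ObF F"
  by (simp add: pmv_to_rel_def)

lemma Mor_P1_disc: "Mor (P1 (disc D)) =
    {s. Src s \<subseteq> Ob D \<and> Tgt s \<subseteq> Ob D \<and> Via s \<subseteq> Homs D (Src s) (Tgt s)}"
  by (auto simp: Mor_P1 down_disc)

lemma power_comp_disc:
  assumes "category D"
  shows "power_comp (disc D) t s = {Cmp D g f | g f. f \<in> s \<and> g \<in> t \<and> composable D g f}"
  using category.Cmp[OF assms] by (auto simp: power_comp_def down_disc Hom_def)

text \<open>Monotonicity reduces to reflexivity because the source order is equality. Under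
  \<open>fmap_between\<close> the tags on both sides of each lax condition agree, which leaves an
  inclusion between the \<open>Via\<close> sets.\<close>

lemma functorder_disc_iff:
  assumes "category C" "category D"
  shows "functorder (disc C) (P1 (disc D)) F \<longleftrightarrow> fmap_between (disc C) (P1 (disc D)) F \<and>
     (\<forall>X\<in>Ob C. Via (MorF F (Idn C X)) \<subseteq> Idn D ` ObF F X) \<and>
     (\<forall>f g. composable C g f \<longrightarrow> Via (MorF F (Cmp C g f)) \<subseteq>
        {Cmp D e d | e d. d \<in> Via (MorF F f) \<and> e \<in> Via (MorF F g) \<and> composable D e d})"
    (is "_ \<longleftrightarrow> ?b \<and> ?i \<and> ?c")
proof (cases ?b)
  case True
  interpret C: categorder "disc C" using assms by (rule_tac categorder_disc)
  interpret D: categorder "disc D" using assms by (rule_tac categorder_disc)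
  interpret P: categorder "P1 (disc D)" by (rule categorder_P1) unfold_locales
  have ob: "ObF F X \<subseteq> Ob D" if "X \<in> Ob C" for X
    using True that by (auto simp: fmap_between_P1)
  have mor: "MorF F f \<in> Mor (P1 (disc D))" "Src (MorF F f) = ObF F (Dom C f)"
      "Tgt (MorF F f) = ObF F (Cod C f)" if "f \<in> Mor C" for f
    using True that by (auto simp: fmap_between_P1)
  have i: "(MorF F (Idn C X), Idn (P1 (disc D)) (ObF F X)) \<in> Le (P1 (disc D)) \<longleftrightarrow>
      Via (MorF F (Idn C X)) \<subseteq> Idn D ` ObF F X" if X: "X \<in> Ob C" for X
  proof -
    \<comment> \<open>In \<open>disc D\<close> the down closure only intersects with
      \<open>Mor D\<close>, so it fixes this set of identities.\<close>
    have "Idn D ` ObF F X \<subseteq> Mor D"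
      using ob[OF X] D.Idn_Mor by auto
    then have "down (disc D) (Idn D ` ObF F X) = Idn D ` ObF F X"
      by (auto simp: down_disc)
    moreover have "Idn C X \<in> Mor C" "Dom C (Idn C X) = X" "Cod C (Idn C X) = X"
      using X C.Idn_Mor by auto
    moreover have "Idn (P1 (disc D)) (ObF F X) \<in> Mor (P1 (disc D))"
      using ob[OF X] by (intro P.Idn_Mor) (simp add: Ob_P1)
    ultimately show ?thesis
      using ob[OF X] by (auto simp: Le_P1 mor Idn_P1)
  qed
  have c: "(MorF F (Cmp C g f), Cmp (P1 (disc D)) (MorF F g) (MorF F f)) \<in> Le (P1 (disc D)) \<longleftrightarrow>
      Via (MorF F (Cmp C g f)) \<subseteq>
        {Cmp D e d | e d. d \<in> Via (MorF F f) \<and> e \<in> Via (MorF F g) \<and> composable D e d}"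
    if gf: "composable C g f" for g f
  proof -
    have "f \<in> Mor C" "g \<in> Mor C" "Dom C g = Cod C f"
      using gf by (auto simp: composable_def)
    moreover from this have co: "composable (P1 (disc D)) (MorF F g) (MorF F f)"
      by (simp add: composable_P1 mor)
    moreover have "Cmp C g f \<in> Mor C" "Dom C (Cmp C g f) = Dom C f" "Cod C (Cmp C g f) = Cod C g"
      using gf C.Cmp_Mor by auto
    ultimately show ?thesis
      using P.Cmp_Mor(1)[OF co]
      by (simp add: Le_P1 Cmp_P1 mor power_comp_disc assms)
  qed
  show ?thesis
    using True C.categorder_axioms P.categorder_axioms P.Le_refl mor i c
    by (auto simp: functorder_def)
qed (simp add: functorder_def)

lemma functorder_pmv_to_rel:
  assumes F: "pmv_functor C D F"
  shows "functorder (disc C) (P1 (disc D)) (pmv_to_rel C F)"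
proof -
  have cats: "category C" "category D" using F by (simp_all add: pmv_functor_def)
  interpret C: categorder "disc C" using cats by (rule_tac categorder_disc)
  have "fmap_between (disc C) (P1 (disc D)) (pmv_to_rel C F)"
    using F pmv_functor_ObD[OF F] pmv_functor_MorD[OF F] C.Dom_Ob C.Cod_Ob
    by (auto simp: fmap_between_P1 Mor_P1_disc pmv_to_rel_def pmv_functor_def subset_iff)
  \<comment> \<open>These memberships let the restricted \<open>MorF\<close> of
    \<open>pmv_to_rel\<close> evaluate at identities, composites and their factors.\<close>
  moreover have "Idn C X \<in> Mor C" if "X \<in> Ob C" for X
    using C.Idn_Mor that by auto
  moreover have "Cmp C g f \<in> Mor C \<and> g \<in> Mor C \<and> f \<in> Mor C" if "composable C g f" for g f
    using C.Cmp_Mor that by (auto simp: composable_def)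
  ultimately show ?thesis
    using F unfolding functorder_disc_iff[OF cats]
    by (fastforce simp: pmv_to_rel_def pmv_functor_def)
qed

lemma pmv_functor_rel_to_pmv:
  assumes cats: "category C" "category D" and F: "functorder (disc C) (P1 (disc D)) F"
  shows "pmv_functor C D (rel_to_pmv C F)"
proof -
  interpret C: categorder "disc C" using cats by (rule_tac categorder_disc)
  have "fmap_between (disc C) (P1 (disc D)) F"
    using F by (simp add: functorder_def)
  then have ob: "ObF F \<in> Ob C \<rightarrow>\<^sub>E Pow (Ob D)"
    and mor: "\<And>f. f \<in> Mor C \<Longrightarrow> MorF F f \<in> Mor (P1 (disc D)) \<and>
      Src (MorF F f) = ObF F (Dom C f) \<and> Tgt (MorF F f) = ObF F (Cod C f)"
    by (auto simp: fmap_between_P1)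
  have "Via (MorF F f) \<subseteq> Homs D (ObF F (Dom C f)) (ObF F (Cod C f))" if "f \<in> Mor C" for f
    using mor[OF that] by (auto simp: Mor_P1_disc)
  moreover note ob
  moreover have "Idn C X \<in> Mor C" if "X \<in> Ob C" for X
    using C.Idn_Mor that by auto
  moreover have "Cmp C g f \<in> Mor C \<and> g \<in> Mor C \<and> f \<in> Mor C" if "composable C g f" for g f
    using C.Cmp_Mor that by (auto simp: composable_def)
  ultimately show ?thesis
    using F cats unfolding functorder_disc_iff[OF cats]
    by (fastforce simp: rel_to_pmv_def pmv_functor_def)
qed

text \<open>The morphism part of the isomorphism, one hom set at a time.\<close>

lemma bij_betw_pmv_to_rel:
  assumes "category C" "category D"
  shows "bij_betw (pmv_to_rel C) {F. pmv_functor C D F} {F. functorder (disc C) (P1 (disc D)) F}"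
proof (rule bij_betw_byWitness[where f' = "rel_to_pmv C"])
  show "\<forall>F\<in>{F. pmv_functor C D F}. rel_to_pmv C (pmv_to_rel C F) = F"
    by (auto intro!: fmap.equality dest!: pmv_functor_ext
        simp: rel_to_pmv_def pmv_to_rel_def extensional_def fun_eq_iff)
  show "\<forall>F\<in>{F. functorder (disc C) (P1 (disc D)) F}. pmv_to_rel C (rel_to_pmv C F) = F"
  proof clarify
    fix F assume "functorder (disc C) (P1 (disc D)) F"
    then have "fmap_between (disc C) (P1 (disc D)) F"
      by (simp add: functorder_def)
    \<comment> \<open>By \<open>fmap_between\<close> the tags of \<open>MorF F f\<close> are the
      values of \<open>ObF F\<close> at the endpoints of \<open>f\<close>, exactly those that
      \<open>pmv_to_rel\<close> restores.\<close>
    then have "MorF (pmv_to_rel C (rel_to_pmv C F)) = MorF F"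
      by (auto simp: fmap_between_P1 rel_to_pmv_def pmv_to_rel_def extensional_def fun_eq_iff
          intro: arr.expand)
    then show "pmv_to_rel C (rel_to_pmv C F) = F"
      by (intro fmap.equality) (simp_all add: rel_to_pmv_def pmv_to_rel_def)
  qed
qed (use assms functorder_pmv_to_rel pmv_functor_rel_to_pmv in auto)

section \<open>Comparison of identities and composites\<close>

lemma eta_disc:
  assumes "category C"
  shows "eta (disc C) = pmv_to_rel C (pmv_id C)"
proof -
  have "Dom C f \<in> Ob C" "Cod C f \<in> Ob C" if "f \<in> Mor C" for f
    using that category.Dom[OF assms] category.Cod[OF assms] by auto
  then show ?thesis
    \<comment> \<open>For a morphism \<open>f\<close> the discrete down closure of the singleton of
      \<open>f\<close> is that singleton.\<close>
    by (auto simp: eta_def pmv_to_rel_def pmv_id_def down_disc fun_eq_iff restrict_def)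
qed

text \<open>By \<open>Kleisli_extension\<close> the extended \<open>G\<close> sends the arrow
  \<open>MorF (pmv_to_rel C F) f\<close> to unions over its tags and its \<open>Via\<close>; these
  are the unions that define \<open>pmv_comp\<close>.\<close>

lemma Kleisli_comp_disc:
  assumes F: "pmv_functor C D F" and G: "pmv_functor D E G"
  shows "fmap_comp (disc C) (mu (disc E))
      (fmap_comp (disc C) (P1_map (disc D) (P1 (disc E)) (pmv_to_rel D G)) (pmv_to_rel C F))
    = pmv_to_rel C (pmv_comp C G F)"
proof -
  note ext = Kleisli_extension[OF functorder_pmv_to_rel[OF G]]
  have "fmap_between (disc C) (P1 (disc D)) (pmv_to_rel C F)"
    using functorder_pmv_to_rel[OF F] by (simp add: functorder_def)
  then have mor: "f \<in> Mor C \<Longrightarrow> MorF (pmv_to_rel C F) f \<in> Mor (P1 (disc D))" for f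
    by (simp add: fmap_between_P1)
  have "category C" using F by (simp add: pmv_functor_def)
  then have Ob: "Dom C f \<in> Ob C" "Cod C f \<in> Ob C" if "f \<in> Mor C" for f
    using that category.Dom[OF \<open>category C\<close>] category.Cod[OF \<open>category C\<close>] by auto
  \<comment> \<open>Each such \<open>d\<close> is a morphism of \<open>D\<close>, where
    \<open>Via\<close> undoes the tagging.\<close>
  have Via: "(\<Union>d\<in>MorF F f. Via (MorF (pmv_to_rel D G) d)) = (\<Union>d\<in>MorF F f. MorF G d)" if "f \<in> Mor C" for f
    using pmv_functor_Mor_subset[OF F that] by (intro SUP_cong) (auto simp: pmv_to_rel_def)
  show ?thesis
  proof (rule fmap.equality)
    show "ObF (fmap_comp (disc C) (mu (disc E))
          (fmap_comp (disc C) (P1_map (disc D) (P1 (disc E)) (pmv_to_rel D G)) (pmv_to_rel C F)))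
        = ObF (pmv_to_rel C (pmv_comp C G F))"
      by (auto simp: fmap_comp_def ext pmv_functor_ObD[OF F] pmv_comp_def fun_eq_iff)
    show "MorF (fmap_comp (disc C) (mu (disc E))
          (fmap_comp (disc C) (P1_map (disc D) (P1 (disc E)) (pmv_to_rel D G)) (pmv_to_rel C F)))
        = MorF (pmv_to_rel C (pmv_comp C G F))"
    proof
      fix f
      show "MorF (fmap_comp (disc C) (mu (disc E))
          (fmap_comp (disc C) (P1_map (disc D) (P1 (disc E)) (pmv_to_rel D G)) (pmv_to_rel C F))) f
        = MorF (pmv_to_rel C (pmv_comp C G F)) f"
      \<comment> \<open>Off \<open>Mor C\<close> both sides are \<open>undefined\<close>.\<close>
      proof (cases "f \<in> Mor C")
        case True
        have F_f: "MorF (pmv_to_rel C F) f = Arr (ObF F (Dom C f)) (MorF F f) (ObF F (Cod C f))"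
          using True by (simp add: pmv_to_rel_def)
        show ?thesis
          using True mor[OF True] Via[OF True]
          by (simp add: fmap_comp_def ext F_f) (simp add: pmv_to_rel_def pmv_comp_def Ob)
      qed (simp add: fmap_comp_def pmv_to_rel_def)
    qed
  qed simp
qed

theorem theorem6p1:
  "isomorphic_cats
     (Cat_pmv :: (('o, 'm) cat, (('o, 'm) cat, ('o, 'm) pmv_map) arr) cat)
     (full_subcat (Rel1 :: (('o, 'm) cato, (('o, 'm) cato, ('o, 'm) rel1_map) arr) cat)
        {C. discrete C})"
  \<comment> \<open>Both sides become instances of \<open>arr_cat\<close>, the right one with the
    discrete categorders as objects.\<close>
  unfolding Rel1_def full_subcat_arr_cat unfolding Cat_pmv_eq
proof (rule isomorphic_arr_cats[where p = disc and q = "\<lambda>C D. pmv_to_rel C"])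
  show "category (arr_cat {C. category C} (\<lambda>C D. {F. pmv_functor C D F})
      pmv_id (\<lambda>C D E. pmv_comp C) :: (('o, 'm) cat, (('o, 'm) cat, ('o, 'm) pmv_map) arr) cat)"
    using category_Cat_pmv unfolding Cat_pmv_eq .
\<comment> \<open>The four facts settle, in order, the bijection on objects, the bijections on hom
  sets, the identities and the composites.\<close>
qed (auto simp: bij_betw_disc bij_betw_pmv_to_rel eta_disc Kleisli_comp_disc)

end
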